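(* Let $a,b$ be positive integers, $P=[a]\times[b]$, $\mathbb{S}$ a skew field of characteristic zero and $C$ a generic element of the center of $\mathbb{S}$. For a (generic) labeling $g\in\mathbb{S}^P$, $\operatorname{ST}_{\operatorname{NAR}(g)}(i)=\operatorname{ST}_g(i-1)$ for $2\leq i\leq a+b$ and $\operatorname{ST}_{\operatorname{NAR}(g)}(1)=\operatorname{ST}_g(a+b)$.
   Context: $[n]=\{1,\dots,n\}$; $P=[a]\times[b]$ has componentwise order, and $(i,j)$ is covered exactly by $(i+1,j)$ and $(i,j+1)$ when these lie in $P$. Write $\overline{x}=x^{-1}$ for $x\in\mathbb{S}$. All maps are rational maps on $\mathbb{S}^P$ (labelings $P\to\mathbb{S}$), defined for generic labelings. Define: $(\Theta f)(x)=C\cdot\overline{f(x)}$; $(\nabla f)(x)=f(x)\cdot\overline{\sum_{y\lessdot x}f(y)}$, where the empty sum (for $x$ minimal) is replaced by $1$; $(\Delta^{-1}f)(x)=\sum f(y_k)\cdots f(y_2)f(y_1)$ over all saturated chains $x=y_1\lessdot y_2\lessdot\cdots\lessdot y_k$ with $y_k$ maximal in $P$, equivalently $(\Delta^{-1}f)(x)=\big(\sum_{y\gtrdot x}(\Delta^{-1}f)(y)\big)\cdot f(x)$ with the empty sum equal to $1$. Noncommutative antichain rowmotion is $\operatorname{NAR}=\nabla\circ\Theta\circ\Delta^{-1}$. The Stanley--Thomas word of $g$ is the $(a+b)$-tuple with $\operatorname{ST}_g(i)=g(i,b)\cdot g(i,b-1)\cdots g(i,1)$ for $1\le i\le a$ and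 $\operatorname{ST}_g(i)=C\cdot\overline{g(1,i-a)}\cdot\overline{g(2,i-a)}\cdots\overline{g(a,i-a)}$ for $a+1\le i\le a+b$. *)

theory Defs
  imports Complex_Main "HOL-Library.Product_Order"
begin

(* The order on pairs is the componentwise one of Product_Order.
   Labelings of P = rect a b are total functions on nat \<times> nat;
   values outside rect a b are never used. *)

definition rect :: "nat \<Rightarrow> nat \<Rightarrow> (nat \<times> nat) set" where
  "rect a b = {1..a} \<times> {1..b}"

definition covers :: "nat \<Rightarrow> nat \<Rightarrow> nat \<times> nat \<Rightarrow> nat \<times> nat \<Rightarrow> bool" where
  "covers a b x y \<longleftrightarrow> x \<in> rect a b \<and> y \<in> rect a b \<and> x < y \<and>
     \<not> (\<exists>z \<in> rect a b. x < z \<and> z < y)"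

definition maximal_in :: "nat \<Rightarrow> nat \<Rightarrow> nat \<times> nat \<Rightarrow> bool" where
  "maximal_in a b x \<longleftrightarrow> x \<in> rect a b \<and> \<not> (\<exists>z \<in> rect a b. x < z)"

definition sat_chains :: "nat \<Rightarrow> nat \<Rightarrow> nat \<times> nat \<Rightarrow> (nat \<times> nat) list set" where
  "sat_chains a b x = {ys. ys \<noteq> [] \<and> hd ys = x \<and> set ys \<subseteq> rect a b \<and>
     successively (covers a b) ys \<and> maximal_in a b (last ys)}"

(* For a chain y_1, ..., y_k the product is f(y_k) ... f(y_1), hence rev. *)
definition Delta_inv ::
  "nat \<Rightarrow> nat \<Rightarrow> (nat \<times> nat \<Rightarrow> 'a::division_ring) \<Rightarrow> nat \<times> nat \<Rightarrow> 'a" where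
  "Delta_inv a b f x = (\<Sum>ys \<in> sat_chains a b x. prod_list (map f (rev ys)))"

definition Theta ::
  "'a::division_ring \<Rightarrow> (nat \<times> nat \<Rightarrow> 'a) \<Rightarrow> nat \<times> nat \<Rightarrow> 'a" where
  "Theta C f x = C * inverse (f x)"

definition lower_sum ::
  "nat \<Rightarrow> nat \<Rightarrow> (nat \<times> nat \<Rightarrow> 'a::division_ring) \<Rightarrow> nat \<times> nat \<Rightarrow> 'a" where
  "lower_sum a b f x =
     (if {y. covers a b y x} = {} then 1 else (\<Sum>y \<in> {y. covers a b y x}. f y))"

definition nabla ::
  "nat \<Rightarrow> nat \<Rightarrow> (nat \<times> nat \<Rightarrow> 'a::division_ring) \<Rightarrow> nat \<times> nat \<Rightarrow> 'a" where
  "nabla a b f x = f x * inverse (lower_sum a b f x)"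

definition NAR ::
  "nat \<Rightarrow> nat \<Rightarrow> 'a::division_ring \<Rightarrow> (nat \<times> nat \<Rightarrow> 'a) \<Rightarrow> nat \<times> nat \<Rightarrow> 'a" where
  "NAR a b C = nabla a b \<circ> Theta C \<circ> Delta_inv a b"

definition ST ::
  "nat \<Rightarrow> nat \<Rightarrow> 'a::division_ring \<Rightarrow> (nat \<times> nat \<Rightarrow> 'a) \<Rightarrow> nat \<Rightarrow> 'a" where
  "ST a b C g i =
     (if i \<le> a then prod_list (map (\<lambda>j. g (i, j)) (rev [1..<Suc b]))
      else C * prod_list (map (\<lambda>k. inverse (g (k, i - a))) [1..<Suc a]))"

(* NAR is a rational map, whereas inverse 0 = 0 makes the function NAR total. NAR_defined is its
   domain of definition: everything that Theta or nabla inverts is nonzero. The lemmas below show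
   that on this domain (for C nonzero) g and NAR g are nowhere zero on P, so that ST is also
   defined at both, and that the domain is nonempty in characteristic zero. *)
definition NAR_defined ::
  "nat \<Rightarrow> nat \<Rightarrow> 'a::division_ring \<Rightarrow> (nat \<times> nat \<Rightarrow> 'a) \<Rightarrow> bool" where
  "NAR_defined a b C g \<longleftrightarrow>
     (\<forall>x \<in> rect a b. Delta_inv a b g x \<noteq> 0) \<and>
     (\<forall>x \<in> rect a b. lower_sum a b (Theta C (Delta_inv a b g)) x \<noteq> 0)"

lemma covers_iff:
  "covers a b (i, j) y \<longleftrightarrow>
     (i, j) \<in> rect a b \<and> y \<in> rect a b \<and> (y = (Suc i, j) \<or> y = (i, Suc j))"
proof
  assume c: "covers a b (i, j) y"
  obtain k l where y: "y = (k, l)" by (cases y)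
  have 1: "(i, j) \<in> rect a b" "y \<in> rect a b" "i \<le> k" "j \<le> l" "i < k \<or> j < l"
    using c by (auto simp: covers_def y less_le)
  show "(i, j) \<in> rect a b \<and> y \<in> rect a b \<and> (y = (Suc i, j) \<or> y = (i, Suc j))"
  proof (rule ccontr)
    assume n: "\<not> ?thesis"
    define z where "z = (if i < k then (Suc i, j) else (i, Suc j))"
    have "z \<in> rect a b \<and> (i, j) < z \<and> z < y"
      using 1 n by (auto simp: z_def y rect_def less_le)
    then show False using c by (auto simp: covers_def)
  qed
next
  assume "(i, j) \<in> rect a b \<and> y \<in> rect a b \<and> (y = (Suc i, j) \<or> y = (i, Suc j))"
  then show "covers a b (i, j) y"
    by (auto simp: covers_def less_le)
qed

lemma maximal_in_iff:
  "maximal_in a b x \<longleftrightarrow> x \<in> rect a b \<and> {y. covers a b x y} = {}"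
proof -
  obtain i j where x: "x = (i, j)" by (cases x)
  have "\<exists>y. covers a b x y" if "x \<in> rect a b" "z \<in> rect a b" "x < z" for z
  proof -
    obtain k l where z: "z = (k, l)" by (cases z)
    have "i \<le> k" "j \<le> l" "i < k \<or> j < l" using that by (auto simp: x z less_le)
    then show ?thesis using that
      by (intro exI[of _ "if i < k then (Suc i, j) else (i, Suc j)"])
         (auto simp: x z covers_iff rect_def)
  qed
  moreover have "y \<in> rect a b \<and> x < y" if "covers a b x y" for y
    using that by (simp add: covers_def)
  ultimately show ?thesis unfolding maximal_in_def by blast
qed

lemma finite_covers [simp]: "finite {y. covers a b x y}" "finite {y. covers a b y x}"
proof -
  have "finite (rect a b)" by (simp add: rect_def)
  then show "finite {y. covers a b x y}" "finite {y. covers a b y x}"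
    by (auto simp: covers_def intro: finite_subset[of _ "rect a b"])
qed

lemma sat_chains_rec:
  assumes "x \<in> rect a b"
  shows "sat_chains a b x =
    (if {y. covers a b x y} = {} then {[x]}
     else (\<Union>y \<in> {y. covers a b x y}. (#) x ` sat_chains a b y))"
proof (cases "{y. covers a b x y} = {}")
  case True
  then have "maximal_in a b x" using assms by (simp add: maximal_in_iff)
  then have "ys \<in> sat_chains a b x \<longleftrightarrow> ys = [x]" for ys
    using True by (cases ys; cases "tl ys") (auto simp: sat_chains_def maximal_in_def)
  then show ?thesis using True by auto
next
  case False
  then have "\<not> maximal_in a b x" by (simp add: maximal_in_iff)
  then have "ys \<in> sat_chains a b x \<longleftrightarrow>
      (\<exists>y zs. covers a b x y \<and> zs \<in> sat_chains a b y \<and> ys = x # zs)" for ys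
    using assms by (cases ys; cases "tl ys") (auto simp: sat_chains_def)
  then show ?thesis unfolding if_not_P[OF False] by blast
qed

lemma sat_chains_finite_nonempty:
  assumes "x \<in> rect a b"
  shows "finite (sat_chains a b x) \<and> sat_chains a b x \<noteq> {}"
  using assms
proof (induction "(a - fst x) + (b - snd x)" arbitrary: x rule: less_induct)
  case less
  have "finite (sat_chains a b y) \<and> sat_chains a b y \<noteq> {}" if "covers a b x y" for y
    using that by (intro less.hyps; cases x) (auto simp: covers_iff rect_def)
  then show ?case using less.prems by (auto simp: sat_chains_rec)
qed

lemma Delta_inv_rec:
  assumes "x \<in> rect a b"
  shows "Delta_inv a b f x =
    (if {y. covers a b x y} = {} then 1
     else (\<Sum>y \<in> {y. covers a b x y}. Delta_inv a b f y)) * f x"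
proof (cases "{y. covers a b x y} = {}")
  case True
  then show ?thesis using assms by (simp add: Delta_inv_def sat_chains_rec)
next
  case False
  have fin: "finite (sat_chains a b y)" if "covers a b x y" for y
    using that sat_chains_finite_nonempty[of y a b] by (auto simp: covers_def)
  have "Delta_inv a b f x =
      (\<Sum>y \<in> {y. covers a b x y}. \<Sum>ys \<in> (#) x ` sat_chains a b y. prod_list (map f (rev ys)))"
    unfolding Delta_inv_def sat_chains_rec[OF assms] if_not_P[OF False]
    by (rule sum.UNION_disjoint) (auto simp: fin, auto simp: sat_chains_def)
  also have "\<dots> = (\<Sum>y \<in> {y. covers a b x y}. Delta_inv a b f y * f x)"
    by (rule sum.cong[OF refl]) (simp add: sum.reindex Delta_inv_def sum_distrib_right)
  finally show ?thesis unfolding if_not_P[OF False] by (simp only: sum_distrib_right)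
qed

lemma NAR_defined_nonzero:
  assumes "NAR_defined a b C g" "C \<noteq> 0" "x \<in> rect a b"
  shows "g x \<noteq> 0" "NAR a b C g x \<noteq> 0"
proof -
  have D: "Delta_inv a b g x \<noteq> 0" using assms by (simp add: NAR_defined_def)
  then show "g x \<noteq> 0"
    using Delta_inv_rec[OF assms(3), of g] by (metis mult_zero_right)
  show "NAR a b C g x \<noteq> 0"
    using assms D by (simp add: NAR_defined_def NAR_def nabla_def) (simp add: Theta_def)
qed

lemma NAR_defined_one:
  fixes C :: "'a :: {division_ring, ring_char_0}"
  assumes "C \<noteq> 0"
  shows "NAR_defined a b C (\<lambda>_. 1)"
proof -
  define n where "n x = card (sat_chains a b x)" for x
  have D: "Delta_inv a b (\<lambda>_. 1 :: 'a) x = of_nat (n x)" for x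
  proof -
    have "prod_list (map (\<lambda>_. 1 :: 'a) xs) = 1" for xs :: "(nat \<times> nat) list"
      by (induction xs) auto
    then show ?thesis by (simp add: Delta_inv_def n_def del: map_replicate_const)
  qed
  have pos: "n x > 0" if "x \<in> rect a b" for x
    using sat_chains_finite_nonempty[OF that] by (simp add: n_def card_gt_0_iff)
  have "lower_sum a b (Theta C (Delta_inv a b (\<lambda>_. 1))) x \<noteq> 0" for x
  proof (cases "{y. covers a b y x} = {}")
    case False
    let ?A = "{y. covers a b y x}"
    define M where "M = (\<Prod>y\<in>?A. n y)"
    have npos: "n y > 0" if "y \<in> ?A" for y using that pos by (auto simp: covers_def)
    have eq: "inverse (of_nat (n y)) * (of_nat M :: 'a) = of_nat (M div n y)" if "y \<in> ?A" for y
    proof -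
      have "M = n y * (M div n y)" using that by (simp add: M_def dvd_prodI)
      then have "(of_nat M :: 'a) = of_nat (n y) * of_nat (M div n y)"
        by (metis of_nat_mult)
      then show ?thesis using npos[OF that] by (simp add: mult.assoc[symmetric])
    qed
    have "(\<Sum>y\<in>?A. C * inverse (of_nat (n y))) * (of_nat M :: 'a) =
        C * of_nat (\<Sum>y\<in>?A. M div n y)"
      by (simp add: sum_distrib_right sum_distrib_left mult.assoc eq)
    moreover have "(\<Sum>y\<in>?A. M div n y) > 0"
    proof -
      have "M > 0" using npos by (auto simp: M_def intro!: prod_pos)
      then have "M div n y > 0" if "y \<in> ?A" for y
        using npos[OF that] that by (simp add: M_def dvd_prodI dvd_imp_le div_greater_zero_iff)
      then show ?thesis using False by (intro sum_pos) auto
    qed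
    ultimately have "(\<Sum>y\<in>?A. C * inverse (of_nat (n y))) \<noteq> (0 :: 'a)"
      using assms by (metis mult_zero_left mult_eq_0_iff of_nat_eq_0_iff less_numeral_extra(3))
    then show ?thesis using False by (simp add: lower_sum_def Theta_def D)
  qed (simp add: lower_sum_def)
  then show ?thesis using pos by (auto simp: NAR_defined_def D)
qed

end

(* Put h = Delta_inv g.  On the last row g is a quotient of consecutive values of h, and on the
   first row so is NAR g, hence the corresponding Stanley--Thomas entries telescope to single values
   of h.  For adjacent rows x (lower) and y (upper) of h one has, on the interior,
     g_j = (y_j + x_(j+1))^-1 x_j  on the row of x,
     (NAR g)_(j+1) = y_(j+1)^-1 (x_(j+1)^-1 + y_j^-1)^-1 = u_(j+1) g_j u_j^-1  on the row of y,
   where u_j = y_j^-1 x_j, so the two row products agree.  The entries indexed above a are C times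
   inverses of column products, and columns behave like rows because the recursions are symmetric
   under transposition. *)

theory Submission
  imports Defs
begin

text \<open>The list is written as in \<open>ST\<close>, so the row entries of \<open>ST\<close>
  unfold to this product; the order of the factors matters because the field is skew.\<close>

definition desc_prod :: "(nat \<Rightarrow> 'a::monoid_mult) \<Rightarrow> nat \<Rightarrow> 'a" where
  "desc_prod f n = prod_list (map f (rev [1..<Suc n]))"

lemma desc_prod_0 [simp]: "desc_prod f 0 = 1"
  by (simp add: desc_prod_def)

lemma desc_prod_Suc [simp]: "desc_prod f (Suc n) = f (Suc n) * desc_prod f n"
  by (simp add: desc_prod_def)

text \<open>Inversion reverses the order of the factors, which turns the ascending column products
  in \<open>ST\<close> into inverses of descending ones.\<close>

lemma inverse_desc_prod:
  fixes f :: "nat \<Rightarrow> 'a::division_ring"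
  shows "(\<forall>k\<in>{1..n}. f k \<noteq> 0) \<Longrightarrow>
    prod_list (map (\<lambda>k. inverse (f k)) [1..<Suc n]) = inverse (desc_prod f n)"
proof (induction n)
  case (Suc n)
  moreover have "desc_prod f m \<noteq> 0" if "m \<le> n" for m
    using that Suc.prems by (induction m) auto
  ultimately show ?case by (simp add: nonzero_inverse_mult_distrib)
qed simp

text \<open>Each \<open>inverse (u j)\<close> meets the \<open>u j\<close> ending the product so far
  and cancels. The start \<open>F 1 = u 1\<close> shifts the index by one and leaves a single
  \<open>u (Suc n)\<close> on the left.\<close>

lemma desc_prod_conjugate:
  fixes u :: "nat \<Rightarrow> 'a::division_ring"
  assumes "\<forall>j\<in>{1..Suc n}. u j \<noteq> 0" and "F 1 = u 1"
    and "\<And>j. 1 \<le> j \<Longrightarrow> j \<le> n \<Longrightarrow> F (Suc j) = u (Suc j) * f j * inverse (u j)"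
  shows "desc_prod F (Suc n) = u (Suc n) * desc_prod f n"
  using assms
proof (induction n)
  case (Suc n)
  have "desc_prod F (Suc (Suc n)) = F (Suc (Suc n)) * (u (Suc n) * desc_prod f n)"
    using Suc.IH Suc.prems by (simp del: desc_prod_Suc add: desc_prod_Suc[of F "Suc n"])
  also have "\<dots> = u (Suc (Suc n)) * f (Suc n) * (inverse (u (Suc n)) * u (Suc n)) * desc_prod f n"
    using Suc.prems(3)[of "Suc n"] by (simp add: mult.assoc)
  finally show ?case using Suc.prems(1) by (simp add: mult.assoc)
qed simp

lemma desc_prod_one [simp]: "desc_prod (\<lambda>_. 1) n = 1"
  by (induction n) auto

text \<open>Telescoping by \<open>desc_prod_conjugate\<close> with
  \<open>u j = C * inverse (h j)\<close> and constant \<open>f = 1\<close>. It serves the first row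
  and the first column of \<open>NAR a b C g\<close>.\<close>

lemma desc_prod_first_line:
  fixes h :: "nat \<Rightarrow> 'a::division_ring"
  assumes "n \<ge> 1" "\<forall>j\<in>{1..n}. h j \<noteq> 0" "C \<noteq> 0" "\<forall>s. C * s = s * C"
    and "F 1 = C * inverse (h 1)"
    and "\<And>j. 1 \<le> j \<Longrightarrow> j < n \<Longrightarrow> F (Suc j) = inverse (h (Suc j)) * h j"
  shows "desc_prod F n = C * inverse (h n)"
proof -
  obtain m where n: "n = Suc m" using assms(1) by (cases n) auto
  have "F (Suc j) = C * inverse (h (Suc j)) * 1 * inverse (C * inverse (h j))"
    if "1 \<le> j" "j \<le> m" for j
  proof -
    have "h j \<noteq> 0" using that n assms(2) by auto
    \<comment> \<open>Centrality brings \<open>C\<close> next to \<open>inverse C\<close>; the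
      factor \<open>1\<close> is the value of the constant \<open>f\<close>.\<close>
    then have "C * inverse (h (Suc j)) * 1 * inverse (C * inverse (h j)) =
        inverse (h (Suc j)) * C * (h j * inverse C)"
      using assms(3) assms(4)[rule_format, of "inverse (h (Suc j))"]
      by (simp add: nonzero_inverse_mult_distrib)
    also have "\<dots> = inverse (h (Suc j)) * (C * h j) * inverse C"
      by (simp only: mult.assoc)
    also have "\<dots> = inverse (h (Suc j)) * (h j * C) * inverse C"
      using assms(4)[rule_format, of "h j"] by (simp only:)
    also have "\<dots> = inverse (h (Suc j)) * h j"
      using assms(3) by (simp add: mult.assoc)
    finally show ?thesis using assms(6) that n by simp
  qed
  then have "desc_prod F (Suc m) = C * inverse (h (Suc m)) * desc_prod (\<lambda>_. 1) m"
    using assms(2,3,5) n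
    by (intro desc_prod_conjugate[where u = "\<lambda>j. C * inverse (h j)" and f = "\<lambda>_. 1"]) auto
  then show ?thesis by (simp add: n)
qed

text \<open>On the last row or column \<open>Delta_inv\<close> sums over one upper cover only, so
  unrolling its recursion from \<open>h 1\<close> collects the factors \<open>f 1\<close>,
  \<open>f 2\<close>, ... from right to left.\<close>

lemma desc_prod_last_line:
  fixes h :: "nat \<Rightarrow> 'a::division_ring"
  assumes "n \<ge> 1" "\<forall>j\<in>{1..n}. h j \<noteq> 0" and "h n = f n"
    and "\<And>j. 1 \<le> j \<Longrightarrow> j < n \<Longrightarrow> h j = h (Suc j) * f j"
  shows "desc_prod f n = h 1"
proof -
  obtain m where n: "n = Suc m" using assms(1) by (cases n) auto
  have "h (Suc k) * desc_prod f k = h 1" if "k \<le> m" for k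
    using that
  proof (induction k)
    case (Suc k)
    then show ?case using assms(4)[of "Suc k"] n by (simp add: mult.assoc[symmetric])
  qed simp
  from this[of m] show ?thesis using assms(3) by (simp add: n)
qed

text \<open>Conjugation by \<open>u j = inverse (y j) * x j\<close> leaves \<open>u n\<close> times
  the product of the first \<open>n - 1\<close> values of \<open>f\<close>; at the end of the line
  \<open>u n\<close> is exactly \<open>f n\<close>, the missing factor.\<close>

lemma desc_prod_adjacent_lines:
  fixes x y :: "nat \<Rightarrow> 'a::division_ring"
  assumes "n \<ge> 1" "\<forall>j\<in>{1..n}. x j \<noteq> 0" "\<forall>j\<in>{1..n}. y j \<noteq> 0"
    and "F 1 = inverse (y 1) * x 1"
    and F: "\<And>j. 1 \<le> j \<Longrightarrow> j < n \<Longrightarrow>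
      F (Suc j) = inverse (y (Suc j)) * inverse (inverse (x (Suc j)) + inverse (y j))"
    and "x n = y n * f n"
    and f: "\<And>j. 1 \<le> j \<Longrightarrow> j < n \<Longrightarrow> x j = (y j + x (Suc j)) * f j"
  shows "desc_prod F n = desc_prod f n"
proof -
  obtain m where n: "n = Suc m" using assms(1) by (cases n) auto
  let ?u = "\<lambda>j. inverse (y j) * x j"
  have "F (Suc j) = ?u (Suc j) * f j * inverse (?u j)" if "1 \<le> j" "j \<le> m" for j
  proof -
    have nz: "x j \<noteq> 0" "x (Suc j) \<noteq> 0" "y j \<noteq> 0"
      using that n assms(2,3) by auto
    have xj: "x j = (y j + x (Suc j)) * f j" using that n by (intro f) auto
    \<comment> \<open>A zero sum would force \<open>x j = 0\<close> by the recursion.\<close>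
    then have s: "y j + x (Suc j) \<noteq> 0" using nz by (metis mult_zero_left)
    have fj: "f j = inverse (y j + x (Suc j)) * x j"
      using s by (subst xj) (simp add: mult.assoc[symmetric])
    \<comment> \<open>This factorization exposes \<open>y j + x (Suc j)\<close>, whose inverse also
      occurs in \<open>f j\<close>; that is the link between \<open>F\<close> and
      \<open>f\<close>.\<close>
    have "inverse (x (Suc j)) + inverse (y j) =
        inverse (y j) * (y j + x (Suc j)) * inverse (x (Suc j))"
      using nz by (simp add: distrib_left distrib_right mult.assoc)
    then have "inverse (inverse (x (Suc j)) + inverse (y j)) =
        x (Suc j) * (inverse (y j + x (Suc j)) * y j)"
      using nz s by (simp add: nonzero_inverse_mult_distrib)
    moreover have "inverse (y j + x (Suc j)) * y j = f j * inverse (?u j)"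
      using nz by (simp add: fj nonzero_inverse_mult_distrib mult.assoc)
        (simp add: mult.assoc[symmetric])
    ultimately show ?thesis using F[of j] that n by (simp add: mult.assoc)
  qed
  then have "desc_prod F (Suc m) = ?u (Suc m) * desc_prod f m"
    using assms n by (intro desc_prod_conjugate) auto
  moreover have "f n = ?u n"
    using assms by (simp add: mult.assoc[symmetric])
  ultimately show ?thesis by (simp add: n)
qed

lemma upper_covers_eq:
  assumes "(i, j) \<in> rect a b"
  shows "{y. covers a b (i, j) y} =
    (if i < a then {(Suc i, j)} else {}) \<union> (if j < b then {(i, Suc j)} else {})"
  using assms by (auto simp: covers_iff rect_def)

lemma lower_covers_eq:
  assumes "(i, j) \<in> rect a b"
  shows "{y. covers a b y (i, j)} =
    (if 1 < i then {(i - 1, j)} else {}) \<union> (if 1 < j then {(i, j - 1)} else {})"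
  using assms by (auto simp: covers_iff rect_def)

lemma Delta_inv_rect:
  assumes "(i, j) \<in> rect a b"
  shows "Delta_inv a b f (i, j) =
    (if i < a then if j < b then Delta_inv a b f (Suc i, j) + Delta_inv a b f (i, Suc j)
                   else Delta_inv a b f (Suc i, j)
     else if j < b then Delta_inv a b f (i, Suc j) else 1) * f (i, j)"
  by (subst Delta_inv_rec[OF assms]) (simp add: upper_covers_eq[OF assms])

lemma lower_sum_rect:
  assumes "(i, j) \<in> rect a b"
  shows "lower_sum a b f (i, j) =
    (if 1 < i then if 1 < j then f (i - 1, j) + f (i, j - 1) else f (i - 1, j)
     else if 1 < j then f (i, j - 1) else 1)"
  using assms by (auto simp: lower_sum_def lower_covers_eq[OF assms] rect_def)

lemma central_mult_inverse_cancel: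
  fixes C :: "'a::division_ring"
  assumes "C \<noteq> 0" "\<forall>s. C * s = s * C"
  shows "C * p * inverse (C * q) = p * inverse q"
\<comment> \<open>For \<open>q = 0\<close> both sides vanish since \<open>inverse 0 = 0\<close>, so
  the equation rewrites without a side condition on \<open>q\<close>.\<close>
proof (cases "q = 0")
  case False
  have "C * p * inverse (C * q) = p * (C * inverse q) * inverse C"
    using False assms(1) assms(2)[rule_format, of p]
    by (simp add: nonzero_inverse_mult_distrib mult.assoc)
  also have "\<dots> = p * inverse q * (C * inverse C)"
    using assms(2)[rule_format, of "inverse q"] by (simp add: mult.assoc)
  finally show ?thesis using assms(1) by simp
qed simp

text \<open>The central \<open>C\<close> cancels between \<open>Theta C h\<close> and its lower sum
  wherever a lower cover exists. It survives only at \<open>(1, 1)\<close>, where the empty sum is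
  replaced by \<open>1\<close>.\<close>

lemma NAR_rect:
  fixes C :: "'a::division_ring" and g :: "nat \<times> nat \<Rightarrow> 'a"
  assumes "(i, j) \<in> rect a b" "C \<noteq> 0" "\<forall>s. C * s = s * C"
  defines "h \<equiv> Delta_inv a b g"
  shows "NAR a b C g (i, j) =
    (if 1 < i then
       if 1 < j then inverse (h (i, j)) * inverse (inverse (h (i - 1, j)) + inverse (h (i, j - 1)))
       else inverse (h (i, j)) * h (i - 1, j)
     else if 1 < j then inverse (h (i, j)) * h (i, j - 1) else C * inverse (h (i, j)))"
  using central_mult_inverse_cancel[OF assms(2,3)]
  by (simp add: NAR_def nabla_def lower_sum_rect[OF assms(1)] Theta_def h_def[symmetric]
      distrib_left[symmetric])

lemma ST_row: "i \<le> a \<Longrightarrow> ST a b C f i = desc_prod (\<lambda>j. f (i, j)) b"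
  by (simp add: ST_def desc_prod_def)

lemma ST_column:
  assumes "j \<in> {1..b}" "\<forall>x\<in>rect a b. f x \<noteq> 0"
  shows "ST a b C f (a + j) = C * inverse (desc_prod (\<lambda>k. f (k, j)) a)"
proof -
  have "\<forall>k\<in>{1..a}. f (k, j) \<noteq> 0" using assms by (auto simp: rect_def)
  from inverse_desc_prod[OF this] show ?thesis using assms(1) by (simp add: ST_def)
qed

theorem theorem4p5:
  fixes a b :: nat
    and C :: "'a :: {division_ring, ring_char_0}"
    and g :: "nat \<times> nat \<Rightarrow> 'a"
  assumes "a \<ge> 1" and "b \<ge> 1"
    and "\<forall>s. C * s = s * C" and "C \<noteq> 0"
    and "NAR_defined a b C g"
  shows "(\<forall>i \<in> {2..a + b}. ST a b C (NAR a b C g) i = ST a b C g (i - 1)) \<and>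
         ST a b C (NAR a b C g) 1 = ST a b C g (a + b)"
proof -
  define h where "h = Delta_inv a b g"
  define G where "G = NAR a b C g"
  have h0: "h (i, j) \<noteq> 0" if "i \<in> {1..a}" "j \<in> {1..b}" for i j
    using assms(5) that by (simp add: NAR_defined_def h_def rect_def)
  have g0: "\<forall>x\<in>rect a b. g x \<noteq> 0" and G0: "\<forall>x\<in>rect a b. G x \<noteq> 0"
    using NAR_defined_nonzero[OF assms(5,4)] by (auto simp: G_def)
  note h = Delta_inv_rect[of _ _ a b g, folded h_def]
  note G = NAR_rect[OF _ assms(4,3), of _ _ a b g, folded h_def G_def]
  have first_row: "desc_prod (\<lambda>j. G (1, j)) b = C * inverse (h (1, b))"
    using assms(1,2,4) h0
    by (intro desc_prod_first_line) (use assms(3) in blast | simp add: G rect_def)+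
  have first_column: "desc_prod (\<lambda>i. G (i, 1)) a = C * inverse (h (a, 1))"
    using assms(1,2,4) h0
    by (intro desc_prod_first_line) (use assms(3) in blast | simp add: G rect_def)+
  have last_row: "desc_prod (\<lambda>j. g (a, j)) b = h (a, 1)"
  proof (rule desc_prod_last_line)
    show "h (a, j) = h (a, Suc j) * g (a, j)" if "1 \<le> j" "j < b" for j
      using that assms(1) by (subst h) (simp_all add: rect_def)
  qed (use assms(1,2) h0 h[of a b] in \<open>simp_all add: rect_def\<close>)
  have last_column: "desc_prod (\<lambda>i. g (i, b)) a = h (1, b)"
  proof (rule desc_prod_last_line)
    show "h (i, b) = h (Suc i, b) * g (i, b)" if "1 \<le> i" "i < a" for i
      using that assms(2) by (subst h) (simp_all add: rect_def)
  qed (use assms(1,2) h0 h[of a b] in \<open>simp_all add: rect_def\<close>)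
  have rows: "desc_prod (\<lambda>j. G (Suc i, j)) b = desc_prod (\<lambda>j. g (i, j)) b"
    if i: "1 \<le> i" "i < a" for i
  proof (rule desc_prod_adjacent_lines[where x = "\<lambda>j. h (i, j)" and y = "\<lambda>j. h (Suc i, j)"])
    show "h (i, j) = (h (Suc i, j) + h (i, Suc j)) * g (i, j)" if "1 \<le> j" "j < b" for j
      using that i by (subst h) (simp_all add: rect_def)
  qed (use i assms(2) h0 h[of i b] in \<open>simp_all add: G rect_def\<close>)
  have columns: "desc_prod (\<lambda>i. G (i, Suc j)) a = desc_prod (\<lambda>i. g (i, j)) a"
    if j: "1 \<le> j" "j < b" for j
  proof (rule desc_prod_adjacent_lines[where x = "\<lambda>i. h (i, j)" and y = "\<lambda>i. h (i, Suc j)"])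
    \<comment> \<open>Transposition exchanges the two upper covers, so the summands of the recursion
      are swapped.\<close>
    show "h (i, j) = (h (i, Suc j) + h (Suc i, j)) * g (i, j)" if "1 \<le> i" "i < a" for i
      using that j by (subst h) (simp_all add: rect_def add.commute)
  qed (use j assms(1) h0 h[of a j] in \<open>simp_all add: G rect_def add.commute\<close>)
  have "ST a b C G (Suc i) = ST a b C g i" if i: "1 \<le> i" "i < a + b" for i
  proof -
    \<comment> \<open>The shift goes from row to row, from the last row to the first column, or from
      column to column. At the middle transition both entries equal \<open>h (a, 1)\<close>.\<close>
    consider "i < a" | "i = a" | j where "i = a + j" "1 \<le> j" "j < b"
    proof (cases "i \<le> a")
      case False
      then show ?thesis using i by (intro that(3)[of "i - a"]) auto
    qed (use that le_neq_implies_less in blast)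
    then show ?thesis
    proof cases
      case 1
      then show ?thesis using rows i by (simp add: ST_row)
    next
      case 2
      have "ST a b C G (a + 1) = C * inverse (C * inverse (h (a, 1)))"
        using ST_column[of 1, OF _ G0] assms(2) first_column by simp
      also have "\<dots> = h (a, 1)"
        using central_mult_inverse_cancel[OF assms(4,3), of 1 "inverse (h (a, 1))"] by simp
      finally show ?thesis using 2 last_row by (simp add: ST_row)
    next
      case 3
      then show ?thesis
        using ST_column[of j, OF _ g0] ST_column[of "Suc j", OF _ G0] columns by simp
    qed
  qed
  then have "ST a b C G i = ST a b C g (i - 1)" if "i \<in> {2..a + b}" for i
    using that by (cases i) auto
  \<comment> \<open>The cyclic wrap goes from the last column of \<open>g\<close> to the first row
    of \<open>G\<close>; both entries are \<open>C * inverse (h (1, b))\<close>.\<close>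
  moreover have "ST a b C G 1 = ST a b C g (a + b)"
    using assms(1,2) first_row last_column by (simp add: ST_row ST_column[OF _ g0])
  ultimately show ?thesis by (simp add: G_def)
qed

end
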